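(* Let $\Lambda=\Lambda(b,\mathcal{F})$ be a BLPR problem with $M^*<2k^*$ having a basic solution $x$, and suppose some free machine has free capacity $1$. Let $p$ be a machine with free capacity $m_p-c_p=1$, let $q$ be a free job with $t_q$ maximal among all free jobs, let $\mathcal{F}'=\mathcal{F}\cup\{(p,q)\}$ and $b'=(b_1,\dots,b_{p-1},b_p+t_q,b_{p+1},\dots,b_k)$. If $b$ is a feasible upper bounding vector of $\Lambda$, then $b'$ is a feasible upper bounding vector of $\Lambda(b',\mathcal{F}')$, i.e. $\Lambda(b',\mathcal{F}')$ is feasible.
   Context: Given a positive integer $k$, positive integers $m_1,\dots,m_k$, non-negative integers $t_1,\dots,t_M$ with $M\le\sum_i m_i$, a real vector $b=(b_1,\dots,b_k)$ (upper bounding vector) and a set $\mathcal{F}\subseteq\{1,\dots,k\}\times\{1,\dots,M\}$, the BLPR problem $\Lambda(b,\mathcal{F})$ is the feasibility problem in real variables $x_{ij}$ ($1\le i\le k$, $1\le j\le M$): $\sum_j x_{ij}t_j\le b_i$ and $\sum_j x_{ij}\le m_i$ for all $i$; $\sum_i x_{ij}=1$ for all $j$; $x_{ij}=1$ for $(i,j)\in\mathcal{F}$; $x_{ij}\ge0$. The vector $b$ is a feasible upper bounding vector if the problem is feasible. A basic solution is a feasible solution that is the unique solution of a set of linearly independent constraints holding with equality. Let $c_i=|\{j:(i,j)\in\mathcal{F}\}|$; $m_i-c_i$ is the free capacity of machine $i$. A job $j$ is free if $(i,j)\notin\mathcal{F}$ for all $i$; a machine $i$ is free if $c_i<m_i$.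 $M^*$, $k^*$ are the numbers of free jobs and free machines. *)

theory Defs
  imports "HOL-Analysis.Analysis"
begin

text \<open>
  Machines and jobs are the elements of finite types \<open>'i\<close> and \<open>'j\<close>, so \<open>k = CARD('i)\<close> and
  \<open>M = CARD('j)\<close>; an assignment \<open>x :: real^'j^'i\<close> has entries \<open>x $ i $ j\<close>.
\<close>

definition blpr_data :: "('i::finite \<Rightarrow> nat) \<Rightarrow> ('j::finite \<Rightarrow> nat) \<Rightarrow> bool" where
  "blpr_data m t \<longleftrightarrow> (\<forall>i. 0 < m i) \<and> CARD('j) \<le> (\<Sum>i\<in>UNIV. m i)"

definition blpr_solution ::
  "('i::finite \<Rightarrow> nat) \<Rightarrow> ('j::finite \<Rightarrow> nat) \<Rightarrow> ('i \<Rightarrow> real) \<Rightarrow> ('i \<times> 'j) set \<Rightarrow> real^'j^'i \<Rightarrow> bool" where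
  "blpr_solution m t b F x \<longleftrightarrow>
     (\<forall>i. (\<Sum>j\<in>UNIV. x $ i $ j * real (t j)) \<le> b i) \<and>
     (\<forall>i. (\<Sum>j\<in>UNIV. x $ i $ j) \<le> real (m i)) \<and>
     (\<forall>j. (\<Sum>i\<in>UNIV. x $ i $ j) = 1) \<and>
     (\<forall>(i, j)\<in>F. x $ i $ j = 1) \<and>
     (\<forall>i j. 0 \<le> x $ i $ j)"

definition blpr_feasible ::
  "('i::finite \<Rightarrow> nat) \<Rightarrow> ('j::finite \<Rightarrow> nat) \<Rightarrow> ('i \<Rightarrow> real) \<Rightarrow> ('i \<times> 'j) set \<Rightarrow> bool" where
  "blpr_feasible m t b F \<longleftrightarrow> (\<exists>x. blpr_solution m t b F x)"

datatype ('i, 'j) blpr_constraint =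
  Load 'i | Capacity 'i | Assign 'j | Fixed 'i 'j | Nonneg 'i 'j

definition blpr_constraints :: "('i \<times> 'j) set \<Rightarrow> ('i, 'j) blpr_constraint set" where
  "blpr_constraints F =
     range Load \<union> range Capacity \<union> range Assign \<union> (\<lambda>(i, j). Fixed i j) ` F
       \<union> (\<lambda>(i, j). Nonneg i j) ` UNIV"

primrec constraint_coeffs ::
  "('j::finite \<Rightarrow> nat) \<Rightarrow> ('i::finite, 'j) blpr_constraint \<Rightarrow> real^'j^'i" where
  "constraint_coeffs t (Load i) = (\<chi> i' j'. if i' = i then real (t j') else 0)"
| "constraint_coeffs t (Capacity i) = (\<chi> i' j'. if i' = i then 1 else 0)"
| "constraint_coeffs t (Assign j) = (\<chi> i' j'. if j' = j then 1 else 0)"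
| "constraint_coeffs t (Fixed i j) = (\<chi> i' j'. if i' = i \<and> j' = j then 1 else 0)"
| "constraint_coeffs t (Nonneg i j) = (\<chi> i' j'. if i' = i \<and> j' = j then 1 else 0)"

primrec constraint_rhs ::
  "('i \<Rightarrow> nat) \<Rightarrow> ('i \<Rightarrow> real) \<Rightarrow> ('i, 'j) blpr_constraint \<Rightarrow> real" where
  "constraint_rhs m b (Load i) = b i"
| "constraint_rhs m b (Capacity i) = real (m i)"
| "constraint_rhs m b (Assign j) = 1"
| "constraint_rhs m b (Fixed i j) = 1"
| "constraint_rhs m b (Nonneg i j) = 0"

lemma inner_constraint_coeffs:
  fixes x :: "real^'j::finite^'i::finite"
  shows "constraint_coeffs t (Load i) \<bullet> x = (\<Sum>j\<in>UNIV. x $ i $ j * real (t j))"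
    and "constraint_coeffs t (Capacity i) \<bullet> x = (\<Sum>j\<in>UNIV. x $ i $ j)"
    and "constraint_coeffs t (Assign j) \<bullet> x = (\<Sum>i\<in>UNIV. x $ i $ j)"
    and "constraint_coeffs t (Fixed i j) \<bullet> x = x $ i $ j"
    and "constraint_coeffs t (Nonneg i j) \<bullet> x = x $ i $ j"
proof -
  have row: "(\<Sum>i'\<in>UNIV. \<Sum>j'\<in>UNIV. (if i' = i then f j' else 0) * x $ i' $ j')
      = (\<Sum>j'\<in>UNIV. f j' * x $ i $ j')" for f :: "'j \<Rightarrow> real"
  proof -
    have "(\<Sum>i'\<in>UNIV. \<Sum>j'\<in>UNIV. (if i' = i then f j' else 0) * x $ i' $ j')
        = (\<Sum>i'\<in>UNIV. if i' = i then (\<Sum>j'\<in>UNIV. f j' * x $ i $ j') else 0)"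
      by (intro sum.cong) auto
    then show ?thesis by simp
  qed
  have entry: "(\<Sum>i'\<in>UNIV. \<Sum>j'\<in>UNIV. (if i' = i \<and> j' = j then 1 else 0) * x $ i' $ j') = x $ i $ j"
    using row[of "\<lambda>j'. if j' = j then 1 else 0"]
    by (simp add: if_distrib[of "\<lambda>a. a * _"] if_bool_eq_conj[symmetric] cong: if_cong)
       (simp add: if_distrib[of "\<lambda>a. a * _"] flip: if_if_eq_conj cong: if_cong)
  show "constraint_coeffs t (Load i) \<bullet> x = (\<Sum>j\<in>UNIV. x $ i $ j * real (t j))"
    using row[of "\<lambda>j. real (t j)"] by (simp add: inner_vec_def mult.commute)
  show "constraint_coeffs t (Capacity i) \<bullet> x = (\<Sum>j\<in>UNIV. x $ i $ j)"
    using row[of "\<lambda>_. 1"] by (simp add: inner_vec_def)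
  show "constraint_coeffs t (Assign j) \<bullet> x = (\<Sum>i\<in>UNIV. x $ i $ j)"
    by (simp add: inner_vec_def if_distrib[of "\<lambda>a. a * _"] cong: if_cong)
  show "constraint_coeffs t (Fixed i j) \<bullet> x = x $ i $ j"
    using entry by (simp add: inner_vec_def)
  show "constraint_coeffs t (Nonneg i j) \<bullet> x = x $ i $ j"
    using entry by (simp add: inner_vec_def)
qed

text \<open>
  Linear independence is that of the family of coefficient vectors indexed by the constraints in
  \<open>S\<close>; since \<^const>\<open>independent\<close> speaks about sets, injectivity rules out repeated vectors.
\<close>

definition blpr_basic_solution ::
  "('i::finite \<Rightarrow> nat) \<Rightarrow> ('j::finite \<Rightarrow> nat) \<Rightarrow> ('i \<Rightarrow> real) \<Rightarrow> ('i \<times> 'j) set \<Rightarrow> real^'j^'i \<Rightarrow> bool" where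
  "blpr_basic_solution m t b F x \<longleftrightarrow>
     blpr_solution m t b F x \<and>
     (\<exists>S \<subseteq> blpr_constraints F.
        inj_on (constraint_coeffs t) S \<and> independent (constraint_coeffs t ` S) \<and>
        {y. \<forall>c\<in>S. constraint_coeffs t c \<bullet> y = constraint_rhs m b c} = {x})"

definition fixed_count :: "('i \<times> 'j::finite) set \<Rightarrow> 'i \<Rightarrow> nat" where
  "fixed_count F i = card {j. (i, j) \<in> F}"

definition free_capacity :: "('i \<Rightarrow> nat) \<Rightarrow> ('i \<times> 'j::finite) set \<Rightarrow> 'i \<Rightarrow> int" where
  "free_capacity m F i = int (m i) - int (fixed_count F i)"

definition free_job :: "('i \<times> 'j) set \<Rightarrow> 'j \<Rightarrow> bool" where
  "free_job F j \<longleftrightarrow> (\<forall>i. (i, j) \<notin> F)"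

definition free_machine :: "('i \<Rightarrow> nat) \<Rightarrow> ('i \<times> 'j::finite) set \<Rightarrow> 'i \<Rightarrow> bool" where
  "free_machine m F i \<longleftrightarrow> fixed_count F i < m i"

definition num_free_jobs :: "('i \<times> 'j::finite) set \<Rightarrow> nat" where
  "num_free_jobs F = card {j. free_job F j}"

definition num_free_machines :: "('i::finite \<Rightarrow> nat) \<Rightarrow> ('i \<times> 'j::finite) set \<Rightarrow> nat" where
  "num_free_machines m F = card {i. free_machine m F i}"

end

theory Submission
  imports Defs
begin

text \<open>
  The proof is an exchange argument on an arbitrary feasible solution \<open>x\<close>. Machine \<open>p\<close> takes all of
  job \<open>q\<close> and gives up its other non-fixed jobs, whose total amount is at most the amount
  \<open>1 - x $ p $ q\<close> of \<open>q\<close> that it receives. Every other machine \<open>i\<close> gets back a share of them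
  proportional to the amount \<open>x $ i $ q\<close> it gave away. So no other machine gains jobs, and since
  \<open>t q\<close> is maximal none gains load, while \<open>p\<close> gains at most \<open>t q\<close>.
\<close>

text \<open>Relative to the row \<open>v\<close>, the new row loses \<open>v q * w q\<close> and
  gains \<open>v q / s\<close> times the \<open>u\<close>-weighted sum of \<open>w\<close> over
  \<open>D\<close>. That sum is at most \<open>s * w q\<close>, so the gain never exceeds the loss.
  A general weight \<open>w\<close> covers both load (\<open>w = t\<close>) and capacity
  (\<open>w = 1\<close>). The bound on \<open>w j\<close> is asked only where \<open>u j\<close> is
  nonzero, since larger weights elsewhere contribute nothing.\<close>

lemma exchange_row_le:
  fixes u v w :: "'j::finite \<Rightarrow> real"
  assumes "q \<notin> D" and "0 < s" and "0 \<le> v q" and "0 \<le> w q"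
    and u_nonneg: "\<And>j. 0 \<le> u j" and u_sum: "sum u D \<le> s"
    and w_le: "\<And>j. j \<in> D \<Longrightarrow> u j \<noteq> 0 \<Longrightarrow> w j \<le> w q"
  shows "(\<Sum>j\<in>UNIV. (if j = q then 0 else if j \<in> D then v j + u j * v q / s else v j) * w j)
      \<le> (\<Sum>j\<in>UNIV. v j * w j)"
proof -
  have "(\<Sum>j\<in>D. u j * w j) \<le> (\<Sum>j\<in>D. u j * w q)"
    using w_le u_nonneg by (intro sum_mono) (metis mult_left_mono mult_zero_left order_refl)
  also have "\<dots> = sum u D * w q"
    by (simp add: sum_distrib_right)
  also have "\<dots> \<le> s * w q"
    using u_sum \<open>0 \<le> w q\<close> by (rule mult_right_mono)
  finally have "v q / s * (\<Sum>j\<in>D. u j * w j) \<le> v q / s * (s * w q)"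
    using \<open>0 \<le> v q\<close> \<open>0 < s\<close> by (intro mult_left_mono) auto
  then have gain: "v q / s * (\<Sum>j\<in>D. u j * w j) \<le> v q * w q"
    using \<open>0 < s\<close> by simp
  have "(\<Sum>j\<in>UNIV. (if j = q then 0 else if j \<in> D then v j + u j * v q / s else v j) * w j)
      = (\<Sum>j\<in>UNIV. v j * w j + (if j \<in> D then v q / s * (u j * w j) else 0)
          - (if j = q then v q * w q else 0))"
    using \<open>q \<notin> D\<close> by (intro sum.cong) (auto simp: algebra_simps)
  also have "\<dots> = (\<Sum>j\<in>UNIV. v j * w j) + v q / s * (\<Sum>j\<in>D. u j * w j) - v q * w q"
    by (simp add: sum.distrib sum_subtractf sum_distrib_left flip: sum.inter_restrict)
  finally show ?thesis
    using gain by linarith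
qed

lemma blpr_feasible_fix_max_job:
  fixes m :: "'i::finite \<Rightarrow> nat" and t :: "'j::finite \<Rightarrow> nat"
  assumes feas: "blpr_feasible m t b F"
    and cap: "free_capacity m F p = 1"
    and free: "free_job F q" and max: "\<And>j. free_job F j \<Longrightarrow> t j \<le> t q"
  shows "blpr_feasible m t (b(p := b p + real (t q))) (F \<union> {(p, q)})"
proof -
  obtain x where "blpr_solution m t b F x"
    using feas unfolding blpr_feasible_def by blast
  then have load: "\<And>i. (\<Sum>j\<in>UNIV. x $ i $ j * real (t j)) \<le> b i"
    and capa: "\<And>i. (\<Sum>j\<in>UNIV. x $ i $ j) \<le> real (m i)"
    and assign: "\<And>j. (\<Sum>i\<in>UNIV. x $ i $ j) = 1"
    and fix1: "\<And>i j. (i, j) \<in> F \<Longrightarrow> x $ i $ j = 1"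
    and nonneg: "\<And>i j. 0 \<le> x $ i $ j"
    unfolding blpr_solution_def by auto
  \<comment> \<open>\<open>D\<close> holds the jobs that \<open>p\<close> gives up, \<open>C\<close>
    those fixed on \<open>p\<close>, and \<open>s\<close> is the amount of \<open>q\<close> held by
    the other machines.\<close>
  define D where "D = {j. (p, j) \<notin> F \<and> j \<noteq> q}"
  define C where "C = {j. (p, j) \<in> F}"
  define s where "s = 1 - x $ p $ q"
  have q_notin: "(i, q) \<notin> F" for i
    using free by (simp add: free_job_def)
  have UNIV_eq: "UNIV = insert q (C \<union> D)" and disj: "q \<notin> C \<union> D" "C \<inter> D = {}"
    using q_notin by (auto simp: C_def D_def)
  have split: "sum f UNIV = f q + sum f C + sum f D" for f :: "'j \<Rightarrow> real"
    unfolding UNIV_eq using disj by (simp add: sum.union_disjoint)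
  have others: "(\<Sum>i\<in>UNIV - {p}. x $ i $ j) = 1 - x $ p $ j" for j
    using assign[of j] by (simp add: sum_diff1)
  \<comment> \<open>The fixed entry already exhausts the column sum 1.\<close>
  have fixed_elsewhere: "x $ p $ j = 0" if "(i, j) \<in> F" "i \<noteq> p" for i j
  proof -
    have "x $ i $ j \<le> (\<Sum>i\<in>UNIV - {p}. x $ i $ j)"
      using that nonneg by (intro member_le_sum) auto
    then show ?thesis
      using others[of j] fix1[OF that(1)] nonneg[of p j] by linarith
  qed
  \<comment> \<open>\<open>D\<close> may contain jobs fixed on other machines, to which maximality
    of \<open>t q\<close> does not apply; but \<open>p\<close> holds nothing of these.\<close>
  have t_le: "t j \<le> t q" if "j \<in> D" "x $ p $ j \<noteq> 0" for j
    using that fixed_elsewhere by (intro max) (auto simp: D_def free_job_def)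
  have C_one: "x $ p $ j = 1" if "j \<in> C" for j
    using that fix1 by (simp add: C_def)
  have card_C: "real (m p) = real (card C) + 1"
    using cap by (simp add: free_capacity_def fixed_count_def C_def)
  \<comment> \<open>The fixed jobs use \<open>card C\<close> of the capacity
    \<open>card C + 1\<close> of \<open>p\<close>, so \<open>q\<close> and the jobs in
    \<open>D\<close> share a single unit.\<close>
  have D_sum: "(\<Sum>j\<in>D. x $ p $ j) \<le> s"
    using capa[of p] C_one card_C by (simp add: split s_def)
  have "0 \<le> s"
    unfolding s_def others[symmetric] using nonneg by (intro sum_nonneg) auto
  show ?thesis
  \<comment> \<open>If \<open>s = 0\<close>, then \<open>q\<close> already lies wholly on
    \<open>p\<close> and \<open>x\<close> itself serves; otherwise division by \<open>s\<close>
    makes sense.\<close>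
  proof (cases "s = 0")
    case True
    then have "blpr_solution m t (b(p := b p + real (t q))) (F \<union> {(p, q)}) x"
      using load capa assign fix1 nonneg unfolding blpr_solution_def s_def
      by (auto intro: add_increasing2)
    then show ?thesis
      unfolding blpr_feasible_def by blast
  next
    case False
    with \<open>0 \<le> s\<close> have s: "0 < s" by simp
    define y :: "real^'j^'i" where "y = (\<chi> i j.
      if i = p then (if j \<in> insert q C then 1 else 0)
      else if j = q then 0 else if j \<in> D then x $ i $ j + x $ p $ j * x $ i $ q / s else x $ i $ j)"
    have y_p: "y $ p $ j = (if j \<in> insert q C then 1 else 0)" for j
      by (simp add: y_def)
    have y_other: "y $ i $ j = (if j = q then 0 else if j \<in> D
        then x $ i $ j + x $ p $ j * x $ i $ q / s else x $ i $ j)" if "i \<noteq> p" for i j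
      using that by (simp add: y_def)
    have p_row: "(\<Sum>j\<in>UNIV. y $ p $ j * w j) = w q + sum w C" for w :: "'j \<Rightarrow> real"
    proof -
      have "(\<Sum>j\<in>D. y $ p $ j * w j) = 0"
        using disj by (intro sum.neutral) (auto simp: y_p)
      moreover have "(\<Sum>j\<in>C. y $ p $ j * w j) = sum w C"
        by (intro sum.cong) (auto simp: y_p)
      ultimately show ?thesis
        by (simp add: split y_p)
    qed
    have other_row: "(\<Sum>j\<in>UNIV. y $ i $ j * w j) \<le> (\<Sum>j\<in>UNIV. x $ i $ j * w j)"
      if "i \<noteq> p" "0 \<le> w q" "\<And>j. j \<in> D \<Longrightarrow> x $ p $ j \<noteq> 0 \<Longrightarrow> w j \<le> w q" for i w
      unfolding y_other[OF \<open>i \<noteq> p\<close>]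
      using that D_sum s nonneg disj
      by (intro exchange_row_le[where u = "\<lambda>j. x $ p $ j" and v = "\<lambda>j. x $ i $ j"]) auto
    have "(\<Sum>j\<in>UNIV. y $ i $ j * real (t j)) \<le> (b(p := b p + real (t q))) i" for i
    proof (cases "i = p")
      case True
      \<comment> \<open>Now \<open>p\<close> holds exactly \<open>q\<close> and the jobs in
        \<open>C\<close>. The latter were part of its old load, so \<open>b p\<close> covers them
        and the increase \<open>t q\<close> pays for \<open>q\<close>.\<close>
      have "(\<Sum>j\<in>C. real (t j)) = (\<Sum>j\<in>C. x $ p $ j * real (t j))"
        using C_one by (intro sum.cong) auto
      also have "\<dots> \<le> (\<Sum>j\<in>UNIV. x $ p $ j * real (t j))"
        using nonneg by (intro sum_mono2) auto
      also have "\<dots> \<le> b p"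
        by (rule load)
      finally show ?thesis
        using True p_row[of "\<lambda>j. real (t j)"] by simp
    next
      case False
      then show ?thesis
        using other_row[of i "\<lambda>j. real (t j)"] t_le load[of i] by simp
    qed
    moreover have "(\<Sum>j\<in>UNIV. y $ i $ j) \<le> real (m i)" for i
    proof (cases "i = p")
      case True
      then show ?thesis
        using p_row[of "\<lambda>_. 1"] card_C by simp
    next
      case False
      then show ?thesis
        using other_row[of i "\<lambda>_. 1"] capa[of i] by simp
    qed
    moreover have "(\<Sum>i\<in>UNIV. y $ i $ j) = 1" for j
    proof -
      have sum_y: "(\<Sum>i\<in>UNIV. y $ i $ j) = y $ p $ j + (\<Sum>i\<in>UNIV - {p}. y $ i $ j)"
        by (simp add: sum.remove)
      consider "j = q" | "j \<in> D" | "j \<in> C"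
        using UNIV_eq by blast
      then show ?thesis
      proof cases
        case 1
        then have "(\<Sum>i\<in>UNIV - {p}. y $ i $ j) = 0"
          by (intro sum.neutral) (auto simp: y_other)
        then show ?thesis
          unfolding sum_y using 1 by (simp add: y_p)
      next
        case 2
        then have "j \<noteq> q" "j \<notin> C"
          using disj by auto
        \<comment> \<open>The shares \<open>x $ i $ q / s\<close> over the machines other than
          \<open>p\<close> sum to 1, so exactly the amount \<open>x $ p $ j\<close> is handed
          back.\<close>
        have "(\<Sum>i\<in>UNIV - {p}. y $ i $ j)
            = (\<Sum>i\<in>UNIV - {p}. x $ i $ j + x $ p $ j / s * x $ i $ q)"
          using 2 \<open>j \<noteq> q\<close> by (intro sum.cong) (auto simp: y_other)
        also have "\<dots> = 1 - x $ p $ j + x $ p $ j / s * s"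
          by (simp only: sum.distrib others s_def flip: sum_distrib_left)
        also have "\<dots> = 1"
          using s by simp
        finally show ?thesis
          using \<open>j \<noteq> q\<close> \<open>j \<notin> C\<close> by (simp add: sum_y y_p)
      next
        case 3
        then have "(\<Sum>i\<in>UNIV - {p}. y $ i $ j) = (\<Sum>i\<in>UNIV - {p}. x $ i $ j)"
          using disj by (intro sum.cong) (auto simp: y_other)
        then show ?thesis
          using 3 C_one by (simp add: sum_y y_p others)
      qed
    qed
    moreover have "y $ i $ j = 1" if "(i, j) \<in> F \<union> {(p, q)}" for i j
    proof (cases "i = p")
      case True
      then show ?thesis
        using that by (auto simp: y_p C_def)
    next
      case False
      with that have "(i, j) \<in> F" by auto
      \<comment> \<open>As \<open>q\<close> is free, \<open>j\<close> is not \<open>q\<close>; as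
        \<open>j\<close> is fixed on \<open>i\<close>, \<open>p\<close> held none of it and no share
        is added to \<open>x $ i $ j\<close>.\<close>
      then show ?thesis
        using False fixed_elsewhere[of i j] fix1[of i j] q_notin by (auto simp: y_other)
    qed
    moreover have "0 \<le> y $ i $ j" for i j
      using nonneg s by (cases "i = p") (auto simp: y_p y_other)
    ultimately have "blpr_solution m t (b(p := b p + real (t q))) (F \<union> {(p, q)}) y"
      unfolding blpr_solution_def by blast
    then show ?thesis
      unfolding blpr_feasible_def by blast
  qed
qed

theorem theorem2:
  fixes m :: "'i::finite \<Rightarrow> nat" and t :: "'j::finite \<Rightarrow> nat"
    and b b' :: "'i \<Rightarrow> real" and F F' :: "('i \<times> 'j) set"
    and x :: "real^'j^'i" and p :: 'i and q :: 'j
  assumes "blpr_data m t"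
    and "num_free_jobs F < 2 * num_free_machines m F"
    and "blpr_basic_solution m t b F x"
    and "\<exists>i. free_machine m F i \<and> free_capacity m F i = 1"
    and "free_capacity m F p = 1"
    and "free_job F q" and "\<forall>j. free_job F j \<longrightarrow> t j \<le> t q"
    and "F' = F \<union> {(p, q)}"
    and "b' = b(p := b p + real (t q))"
    and "blpr_feasible m t b F"
  shows "blpr_feasible m t b' F'"
  using assms blpr_feasible_fix_max_job by blast

end
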